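(* For each family $\{(y,P(y)):y\in Y\}$ of well-encoded 0/1-polytopes there is a polynomial $g$ such that for every $y\in Y$ there is a block configuration $\mathcal{B}_y$ of size at most $g(\operatorname{len}(y))$ such that $\mathrm{CTP}(\mathcal{B}_y)$ is an extension of $P(y)$ by means of a coordinate projection.
   Context: $\{0,1\}^\star=\bigcup_{\ell\ge1}\{0,1\}^\ell$, and $\operatorname{len}(x)=\ell$ for $x\in\{0,1\}^\ell$. Let $Y\subseteq\{0,1\}^\star$, and for each $y\in Y$ let $m(y)\in\{1,2,\dots\}$ and $X(y)\subseteq\{0,1\}^{m(y)}$; put $P(y)=\operatorname{conv}(X(y))$. The family $\{(y,P(y)):y\in Y\}$ is called a family of well-encoded 0/1-polytopes if there is a polynomial $f$ with $m(y)\le f(\operatorname{len}(y))$ for each $y\in Y$, and the problem to decide for a given pair $(y,x)$ of 0/1-vectors whether $y\in Y$ and $x\in X(y)$ hold is in NP. A polytope $Q$ is an extension of a polytope $P$ if $P$ is the image of $Q$ under some affine map (here: a coordinate projection, up to naming of coordinates). $\mathbb{F}_2$ is the field with two elements. A block configuration in $\mathbb{F}_2^d$ ($d\ge1$) is a sequence $\mathcal{B}=(\mathcal{B}(1),\dots,\mathcal{B}(n))$ with $n\ge2$ of non-empty subsets (blocks) $\mathcal{B}(i)\subseteq\mathbb{F}_2^d$; its size is $\sum_i|\mathcal{B}(i)|$. A cyclic transversal of $\mathcal{B}$ is a sequence $\xi=(\xi(1),\dots,\xi(n))$ with $\xi(i)\in\mathcal{B}(i)$ and $\sum_{i=1}^n\xi(i)=0$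 in $\mathbb{F}_2^d$. Its incidence vector is $x=(x^1,\dots,x^n)$, $x^i\in\{0,1\}^{\mathcal{B}(i)}$, with $x^i_\omega=1$ iff $\xi(i)=\omega$. The cyclic transversal polytope $\mathrm{CTP}(\mathcal{B})\subseteq\mathbb{R}^{\mathcal{B}(1)}\times\cdots\times\mathbb{R}^{\mathcal{B}(n)}$ is the convex hull of the incidence vectors of all cyclic transversals of $\mathcal{B}$ (possibly empty). *)

theory Defs
  imports
    "HOL-Analysis.Convex"
    "HOL-Computational_Algebra.Polynomial"
    "HOL-Library.Function_Algebras"
    "HOL-Library.Z2"
begin

section \<open>Coordinate spaces\<close>

text \<open>
  The dimensions in the statement depend on the instance \<open>y\<close>, so they cannot be fixed by a type.
  For a coordinate set \<open>I\<close> the space \<open>K\<^sup>I\<close> is the set of functions that vanish outside \<open>I\<close>.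
  Together with the pointwise operations of Function\_Algebras, the instance below makes real-valued
  functions on any type a real vector space, so that the library's convex hull applies.
\<close>

definition coord_space :: "'i set \<Rightarrow> ('i \<Rightarrow> 'b::zero) set" where
  "coord_space I = {v. \<forall>i. i \<notin> I \<longrightarrow> v i = 0}"

instantiation "fun" :: (type, real_vector) real_vector
begin

definition scaleR_fun :: "real \<Rightarrow> ('a \<Rightarrow> 'b) \<Rightarrow> 'a \<Rightarrow> 'b" where
  "scaleR_fun r f = (\<lambda>x. r *\<^sub>R f x)"

instance
  by standard (auto simp: scaleR_fun_def fun_eq_iff scaleR_add_right scaleR_add_left)

end

text \<open>
  For an injective \<open>\<sigma>\<close> from \<open>J\<close> to \<open>I\<close>, this is the coordinate projection from \<open>\<real>\<^sup>I\<close> to \<open>\<real>\<^sup>J\<close>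
  that keeps the coordinates in \<open>\<sigma> ` J\<close> and renames the coordinate \<open>\<sigma> j\<close> to \<open>j\<close>.
\<close>

definition coord_proj :: "'j set \<Rightarrow> ('j \<Rightarrow> 'i) \<Rightarrow> ('i \<Rightarrow> real) \<Rightarrow> ('j \<Rightarrow> real)" where
  "coord_proj J \<sigma> x = (\<lambda>j. if j \<in> J then x (\<sigma> j) else 0)"

definition extension_by_coord_proj ::
    "'i set \<Rightarrow> ('i \<Rightarrow> real) set \<Rightarrow> 'j set \<Rightarrow> ('j \<Rightarrow> real) set \<Rightarrow> bool" where
  "extension_by_coord_proj I Q J P \<longleftrightarrow>
     Q \<subseteq> coord_space I \<and> P \<subseteq> coord_space J \<and>
     (\<exists>\<sigma>. inj_on \<sigma> J \<and> \<sigma> ` J \<subseteq> I \<and> coord_proj J \<sigma> ` Q = P)"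


section \<open>NP\<close>

text \<open>
  Nondeterministic Turing machines with one two-way infinite tape, over the input alphabet \<open>'a\<close>.
  A transition \<open>(q, a, q', b, s)\<close> allows the machine, in state \<open>q\<close> and reading \<open>a\<close>, to go to
  state \<open>q'\<close>, write \<open>b\<close> and move the head by \<open>s\<close> cells.
\<close>

datatype 'a tape_symbol = Blank | Input 'a | Aux nat

record 'a ntm =
  ntm_states :: "nat set"
  ntm_symbols :: "'a tape_symbol set"
  ntm_start :: nat
  ntm_accept :: nat
  ntm_trans :: "(nat \<times> 'a tape_symbol \<times> nat \<times> 'a tape_symbol \<times> int) set"

definition wf_ntm :: "'a::finite ntm \<Rightarrow> bool" where
  "wf_ntm M \<longleftrightarrow>
     finite (ntm_states M) \<and> finite (ntm_symbols M) \<and>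
     insert Blank (range Input) \<subseteq> ntm_symbols M \<and>
     ntm_start M \<in> ntm_states M \<and> ntm_accept M \<in> ntm_states M \<and>
     ntm_trans M \<subseteq>
       ntm_states M \<times> ntm_symbols M \<times> ntm_states M \<times> ntm_symbols M \<times> {-1, 0, 1}"

text \<open>Configurations consist of the state, the tape contents and the head position.\<close>

type_synonym 'a config = "nat \<times> (int \<Rightarrow> 'a tape_symbol) \<times> int"

definition initial_config :: "'a ntm \<Rightarrow> 'a list \<Rightarrow> 'a config" where
  "initial_config M w =
     (ntm_start M,
      \<lambda>p. if 0 \<le> p \<and> p < int (length w) then Input (w ! nat p) else Blank,
      0)"

definition ntm_step :: "'a ntm \<Rightarrow> 'a config \<Rightarrow> 'a config \<Rightarrow> bool" where
  "ntm_step M c c' \<longleftrightarrow>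
     (case c of (q, T, h) \<Rightarrow>
        \<exists>q' b s. (q, T h, q', b, s) \<in> ntm_trans M \<and> c' = (q', T(h := b), h + s))"

definition accepts_in :: "'a ntm \<Rightarrow> 'a list \<Rightarrow> nat \<Rightarrow> bool" where
  "accepts_in M w t \<longleftrightarrow>
     (\<exists>T h. (ntm_step M ^^ t) (initial_config M w) (ntm_accept M, T, h))"

definition ntm_language :: "'a ntm \<Rightarrow> 'a list set" where
  "ntm_language M = {w. \<exists>t. accepts_in M w t}"

text \<open>
  As usual for nondeterministic machines, the running time on an accepted word is the length of a
  shortest accepting computation; nothing is required of the other computations.
\<close>

definition NP :: "'a::finite list set set" where
  "NP = {L. \<exists>M (p :: real poly). wf_ntm M \<and> ntm_language M = L \<and>
           (\<forall>w\<in>L. \<exists>t. real t \<le> poly p (real (length w)) \<and> accepts_in M w t)}"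


section \<open>Families of well-encoded 0/1-polytopes\<close>

text \<open>
  0/1-vectors are Boolean lists. A pair \<open>(y, x)\<close> is presented to a machine as the word \<open>y # x\<close>
  over the alphabet \<open>{0, 1, #}\<close>, where \<^const>\<open>None\<close> plays the role of the separator \<open>#\<close>.
\<close>

definition pair_word :: "bool list \<Rightarrow> bool list \<Rightarrow> bool option list" where
  "pair_word y x = map Some y @ [None] @ map Some x"

definition vec01 :: "bool list \<Rightarrow> nat \<Rightarrow> real" where
  "vec01 x = (\<lambda>j. if j < length x then of_bool (x ! j) else 0)"

definition polytope01 :: "bool list set \<Rightarrow> (nat \<Rightarrow> real) set" where
  "polytope01 A = convex hull (vec01 ` A)"

definition well_encoded ::
    "bool list set \<Rightarrow> (bool list \<Rightarrow> nat) \<Rightarrow> (bool list \<Rightarrow> bool list set) \<Rightarrow> bool" where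
  "well_encoded Y m X \<longleftrightarrow>
     (\<forall>y\<in>Y. 1 \<le> length y \<and> 1 \<le> m y \<and> X y \<subseteq> {x. length x = m y}) \<and>
     (\<exists>f :: real poly. \<forall>y\<in>Y. real (m y) \<le> poly f (real (length y))) \<and>
     {pair_word y x | y x. y \<in> Y \<and> x \<in> X y} \<in> NP"


section \<open>Cyclic transversal polytopes\<close>

text \<open>
  The type \<^typ>\<open>bit\<close> is the field with two elements, so \<open>coord_space {..<d}\<close> below is the vector
  space \<open>F\<^sub>2\<^sup>d\<close>. Blocks are indexed from 0.
\<close>

definition block_configuration :: "nat \<Rightarrow> (nat \<Rightarrow> bit) set list \<Rightarrow> bool" where
  "block_configuration d B \<longleftrightarrow>
     1 \<le> d \<and> 2 \<le> length B \<and> (\<forall>i<length B. B ! i \<noteq> {} \<and> B ! i \<subseteq> coord_space {..<d})"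

definition config_size :: "(nat \<Rightarrow> bit) set list \<Rightarrow> nat" where
  "config_size B = (\<Sum>i<length B. card (B ! i))"

definition cyclic_transversals :: "(nat \<Rightarrow> bit) set list \<Rightarrow> (nat \<Rightarrow> bit) list set" where
  "cyclic_transversals B =
     {\<xi>. length \<xi> = length B \<and> (\<forall>i<length B. \<xi> ! i \<in> B ! i) \<and> (\<Sum>i<length B. \<xi> ! i) = 0}"

definition ctp_coords :: "(nat \<Rightarrow> bit) set list \<Rightarrow> (nat \<times> (nat \<Rightarrow> bit)) set" where
  "ctp_coords B = (SIGMA i:{..<length B}. B ! i)"

definition incidence_vector :: "(nat \<Rightarrow> bit) list \<Rightarrow> nat \<times> (nat \<Rightarrow> bit) \<Rightarrow> real" where
  "incidence_vector \<xi> = (\<lambda>(i, \<omega>). of_bool (i < length \<xi> \<and> \<xi> ! i = \<omega>))"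

definition CTP :: "(nat \<Rightarrow> bit) set list \<Rightarrow> (nat \<times> (nat \<Rightarrow> bit) \<Rightarrow> real) set" where
  "CTP B = convex hull (incidence_vector ` cyclic_transversals B)"

end

theory Submission
  imports Defs
begin

text \<open>
  The proof is a variant of the Cook--Levin theorem in which the constraints are linear over \<open>F\<^sub>2\<close>.

  Since the family is well encoded, a nondeterministic Turing machine accepts exactly the words \<open>y # x\<close> with
  \<open>y \<in> Y\<close> and \<open>x \<in> X y\<close>, and it does so within polynomially many steps. For fixed \<open>y\<close>, consider the space-time
  diagram of this machine on a tape whose \<open>x\<close>-part is left open. The diagram is a network of nodes: one
  per step of the head and one per step and tape cell. Each node has polynomially many options, and options
  of neighbouring nodes must match. Two neighbours match iff they agree on certain bits, and
  \<open>b = b'\<close> means \<open>b + b' = 0\<close> in \<open>F\<^sub>2\<close>. Collecting all these equations, a family of options is an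
  accepting run iff the associated vectors over \<open>F\<^sub>2\<close> add up to zero, that is, iff they form a cyclic
  transversal of the block configuration whose blocks are the nodes. The bits of \<open>x\<close> are
  visible in a transversal as the choices made by the input cells, hence are coordinates of its incidence
  vector. A coordinate projection therefore maps the vertices of the cyclic transversal polytope onto
  \<open>X y\<close>, and by linearity it maps the polytope onto the convex hull of \<open>X y\<close>.

  The translation of networks into block configurations is \<open>block_configuration_of_wiring\<close>, the
  correspondence between solutions and runs is \<open>run_of_solution\<close> and \<open>solution_of_run\<close>, and
  \<open>sum_card_choices\<close> bounds the size.
\<close>

section \<open>Wirings\<close>

lemma sum_fun_apply: "(\<Sum>i\<in>A. f i) x = (\<Sum>i\<in>A. f i x)" for f :: "'i \<Rightarrow> 'a \<Rightarrow> 'b::comm_monoid_add"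
  by (induction A rule: infinite_finite_induct) auto

lemma linear_coord_proj: "linear (coord_proj J \<sigma>)"
  by (rule linearI) (auto simp: coord_proj_def scaleR_fun_def fun_eq_iff)

lemma convex_coord_space: "convex (coord_space I :: ('i \<Rightarrow> real) set)"
  by (auto simp: convex_def coord_space_def scaleR_fun_def)

text \<open>
  A wire joins two nodes. Every node chooses, from its own list of options, a set of incident wires
  that it declares active, and a solution is a family of choices in which the two ends of each wire
  agree. Over \<open>F\<^sub>2\<close> agreement is a linear condition: give every wire a coordinate and let a node
  contribute the indicator vector of its active wires; a coordinate of the sum vanishes iff it is hit
  by both ends or by neither.
\<close>

locale wiring =
  fixes V :: "'v set" and A :: "'v \<Rightarrow> 'k set set" and src tgt :: "'k \<Rightarrow> 'v"
  assumes finite_nodes: "finite V" and two_nodes: "2 \<le> card V"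
    and finite_choices: "v \<in> V \<Longrightarrow> finite (A v)"
    and choices_nonempty: "v \<in> V \<Longrightarrow> A v \<noteq> {}"
    and finite_choice: "v \<in> V \<Longrightarrow> S \<in> A v \<Longrightarrow> finite S"
    and incident: "v \<in> V \<Longrightarrow> S \<in> A v \<Longrightarrow> k \<in> S \<Longrightarrow> v = src k \<or> v = tgt k"
    and ends: "v \<in> V \<Longrightarrow> S \<in> A v \<Longrightarrow> k \<in> S \<Longrightarrow> src k \<in> V \<and> tgt k \<in> V \<and> src k \<noteq> tgt k"
begin

definition solutions :: "('v \<Rightarrow> 'k set) set" where
  "solutions = {L. \<forall>v\<in>V. L v \<in> A v \<and> (\<forall>k\<in>L v. k \<in> L (src k) \<and> k \<in> L (tgt k))}"

definition wires :: "'k set" where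
  "wires = (\<Union>v\<in>V. \<Union>(A v))"

lemma finite_wires: "finite wires"
  unfolding wires_def using finite_nodes finite_choices finite_choice by auto

text \<open>
  Every wire is incident to exactly two nodes of \<open>V\<close>, so the number of nodes that activate it is
  0, 1 or 2, and it is even precisely when both ends agree.
\<close>

lemma solution_iff_parity:
  assumes L: "\<And>v. v \<in> V \<Longrightarrow> L v \<in> A v"
  shows "L \<in> solutions \<longleftrightarrow> (\<forall>k\<in>wires. (\<Sum>v\<in>V. of_bool (k \<in> L v)) = (0::bit))"
proof -
  have e: "src k \<in> V \<and> tgt k \<in> V \<and> src k \<noteq> tgt k" if "k \<in> wires" for k
    using that ends unfolding wires_def by (elim UN_E UnionE) blast
  have parity: "(\<Sum>v\<in>V. of_bool (k \<in> L v)) = (of_bool (k \<in> L (src k)) + of_bool (k \<in> L (tgt k)) :: bit)"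
    if "k \<in> wires" for k
  proof -
    note e = e[OF that]
    have "(\<Sum>v\<in>V. of_bool (k \<in> L v)) = (\<Sum>v\<in>{src k, tgt k}. of_bool (k \<in> L v) :: bit)"
    proof (rule sum.mono_neutral_right[OF finite_nodes])
      show "\<forall>v\<in>V - {src k, tgt k}. of_bool (k \<in> L v) = (0::bit)"
        using incident[OF _ L] by auto
    qed (use e in simp)
    then show ?thesis
      using e by (simp del: sum_of_bool_eq)
  qed
  have "L \<in> solutions \<longleftrightarrow> (\<forall>k\<in>wires. k \<in> L (src k) \<longleftrightarrow> k \<in> L (tgt k))"
  proof
    assume "L \<in> solutions"
    then show "\<forall>k\<in>wires. k \<in> L (src k) \<longleftrightarrow> k \<in> L (tgt k)"
      using e by (auto simp: solutions_def)
  next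
    assume *: "\<forall>k\<in>wires. k \<in> L (src k) \<longleftrightarrow> k \<in> L (tgt k)"
    have "k \<in> L (src k) \<and> k \<in> L (tgt k)" if "v \<in> V" "k \<in> L v" for v k
    proof -
      have "k \<in> wires"
        using that L unfolding wires_def by blast
      then show ?thesis
        using * incident[OF \<open>v \<in> V\<close> L[OF \<open>v \<in> V\<close>] \<open>k \<in> L v\<close>] that by auto
    qed
    then show "L \<in> solutions"
      using L unfolding solutions_def by blast
  qed
  then show ?thesis
    by (auto simp del: sum_of_bool_eq simp: parity)
qed

text \<open>
  The blocks are the options of the nodes, written as vectors over \<open>F\<^sub>2\<close>; cyclic transversals are
  then exactly the solutions. The coordinate \<open>j\<close> records whether the node \<open>loc j\<close> makes the choice
  \<open>pat j\<close>. This event is a single coordinate of the incidence vector, so reading off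
  these events is a coordinate projection. Being linear, the projection commutes with convex hulls.
\<close>

theorem block_configuration_of_wiring:
  assumes inj: "inj_on (\<lambda>j. (loc j, pat j)) J"
    and pat: "\<forall>j\<in>J. loc j \<in> V \<and> pat j \<in> A (loc j)"
  shows "\<exists>d B. block_configuration d B \<and> config_size B \<le> (\<Sum>v\<in>V. card (A v)) \<and>
           extension_by_coord_proj (ctp_coords B) (CTP B) J
             (convex hull ((\<lambda>L j. of_bool (j \<in> J \<and> L (loc j) = pat j)) ` solutions))"
proof -
  obtain vs where vs: "set vs = V" "distinct vs"
    using finite_distinct_list[OF finite_nodes] by blast
  define n where "n = length vs"
  have n: "card V = n"
    using vs by (metis distinct_card n_def)
  have nth_V: "vs ! i \<in> V" if "i < n" for i
    using that vs n_def by auto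
  obtain idx where idx: "\<And>v. v \<in> V \<Longrightarrow> idx v < n \<and> vs ! idx v = v"
  proof -
    have "\<forall>v\<in>V. \<exists>i. i < n \<and> vs ! i = v"
      using vs by (auto simp: n_def in_set_conv_nth)
    from bchoice[OF this] show ?thesis
      using that by blast
  qed
  have idx_nth: "idx (vs ! i) = i" if "i < n" for i
    using idx[OF nth_V[OF that]] that nth_eq_iff_index_eq[OF vs(2), of "idx (vs ! i)" i] n_def by simp
  have "bij_betw ((!) vs) {..<n} V"
    using bij_betw_nth[OF vs(2) _ vs(1)[symmetric]] by (simp add: n_def)
  note sum_nth = sum.reindex_bij_betw[OF this]
  obtain e where e: "bij_betw e {0..<card wires} wires"
    using ex_bij_betw_nat_finite[OF finite_wires] by blast
  define vec :: "'k set \<Rightarrow> nat \<Rightarrow> bit" where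
    "vec S = (\<lambda>c. of_bool (c < card wires \<and> e c \<in> S))" for S
  have sub: "S \<subseteq> wires" if "v \<in> V" "S \<in> A v" for v S
    using that unfolding wires_def by blast
  have vec_inj: "S = S'" if "vec S = vec S'" "S \<subseteq> wires" "S' \<subseteq> wires" for S S'
  proof -
    have "k \<in> S \<longleftrightarrow> k \<in> S'" if k: "k \<in> wires" for k
    proof -
      obtain c where "c < card wires" "e c = k"
        using k bij_betw_imp_surj_on[OF e] by (metis atLeastLessThan_iff imageE)
      then show ?thesis
        using fun_cong[OF \<open>vec S = vec S'\<close>, of c] by (auto simp: vec_def of_bool_def split: if_splits)
    qed
    then show ?thesis
      using that by blast
  qed
  \<comment> \<open>The extra coordinate makes the dimension positive even if there are no wires; all vectors vanish there.\<close>
  define d where "d = Suc (card wires)"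
  define B where "B = map (\<lambda>v. vec ` A v) vs"
  have len: "length B = n" and nthB: "\<And>i. i < n \<Longrightarrow> B ! i = vec ` A (vs ! i)"
    by (auto simp: B_def n_def)
  have config: "block_configuration d B"
    unfolding block_configuration_def
    using choices_nonempty nth_V two_nodes n
    by (auto simp: len nthB d_def coord_space_def vec_def)
  have "config_size B \<le> (\<Sum>i<n. card (A (vs ! i)))"
    unfolding config_size_def len
    by (intro sum_mono) (auto simp: nthB intro!: card_image_le finite_choices nth_V)
  then have size: "config_size B \<le> (\<Sum>v\<in>V. card (A v))"
    using sum_nth[of "\<lambda>v. card (A v)"] by simp
  have sum_vec: "(\<Sum>i<n. vec (L (vs ! i))) = 0 \<longleftrightarrow> L \<in> solutions"
    if L: "\<And>v. v \<in> V \<Longrightarrow> L v \<in> A v" for L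
  proof -
    have "(\<Sum>i<n. vec (L (vs ! i))) = 0 \<longleftrightarrow> (\<forall>c. (\<Sum>v\<in>V. vec (L v) c) = 0)"
      by (simp add: fun_eq_iff sum_fun_apply sum_nth[of "\<lambda>v. vec (L v) _"])
    also have "\<dots> \<longleftrightarrow> (\<forall>c\<in>{0..<card wires}. (\<Sum>v\<in>V. of_bool (e c \<in> L v)) = (0::bit))"
    proof -
      have "(\<Sum>v\<in>V. vec (L v) c) = (if c < card wires then \<Sum>v\<in>V. of_bool (e c \<in> L v) else 0)" for c
        by (simp add: vec_def del: sum_of_bool_eq)
      then show ?thesis
        by (auto simp del: sum_of_bool_eq)
    qed
    also have "\<dots> \<longleftrightarrow> (\<forall>k\<in>wires. (\<Sum>v\<in>V. of_bool (k \<in> L v)) = (0::bit))"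
      using ball_simps(9)[of e "{0..<card wires}" "\<lambda>k. (\<Sum>v\<in>V. of_bool (k \<in> L v)) = (0::bit)",
          unfolded bij_betw_imp_surj_on[OF e]] by (rule sym)
    also have "\<dots> \<longleftrightarrow> L \<in> solutions"
      using solution_iff_parity[OF L] by simp
    finally show ?thesis .
  qed
  define \<sigma> where "\<sigma> j = (idx (loc j), vec (pat j))" for j
  let ?out = "\<lambda>L j. of_bool (j \<in> J \<and> L (loc j) = pat j) :: real"
  have proj: "coord_proj J \<sigma> (incidence_vector \<xi>) = ?out L"
    if L: "\<And>v. v \<in> V \<Longrightarrow> L v \<in> A v" and \<xi>: "length \<xi> = n" "\<And>i. i < n \<Longrightarrow> \<xi> ! i = vec (L (vs ! i))"
    for L \<xi>
  proof
    fix j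
    show "coord_proj J \<sigma> (incidence_vector \<xi>) j = ?out L j"
    proof (cases "j \<in> J")
      case True
      then have v: "loc j \<in> V" "pat j \<in> A (loc j)"
        using pat by auto
      have "vec (L (loc j)) = vec (pat j) \<longleftrightarrow> L (loc j) = pat j"
        using vec_inj[OF _ sub[OF v(1) L[OF v(1)]] sub[OF v]] by auto
      then show ?thesis
        using True v idx[OF v(1)] \<xi> by (simp add: coord_proj_def incidence_vector_def \<sigma>_def)
    qed (simp add: coord_proj_def)
  qed
  have img: "coord_proj J \<sigma> ` incidence_vector ` cyclic_transversals B = ?out ` solutions"
  proof (intro equalityI subsetI)
    fix z assume "z \<in> coord_proj J \<sigma> ` incidence_vector ` cyclic_transversals B"
    then obtain \<xi> where z: "z = coord_proj J \<sigma> (incidence_vector \<xi>)"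
      and \<xi>: "length \<xi> = n" "\<And>i. i < n \<Longrightarrow> \<xi> ! i \<in> vec ` A (vs ! i)" "(\<Sum>i<n. \<xi> ! i) = 0"
      unfolding cyclic_transversals_def by (auto simp: len nthB)
    have "\<forall>i. \<exists>S. i < n \<longrightarrow> S \<in> A (vs ! i) \<and> \<xi> ! i = vec S"
      using \<xi>(2) by blast
    then obtain S where S: "\<And>i. i < n \<Longrightarrow> S i \<in> A (vs ! i) \<and> \<xi> ! i = vec (S i)"
      by metis
    \<comment> \<open>An element of a block is the indicator vector of some option of its node; these options form the solution.\<close>
    define L where "L v = S (idx v)" for v
    have LA: "L v \<in> A v" if "v \<in> V" for v
      using S[of "idx v"] idx[OF that] by (simp add: L_def)
    have \<xi>L: "\<xi> ! i = vec (L (vs ! i))" if "i < n" for i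
      using S that by (simp add: L_def idx_nth)
    have "L \<in> solutions"
      using sum_vec[of L] LA \<xi>(3) by (simp add: \<xi>L)
    then show "z \<in> ?out ` solutions"
      using proj[OF LA \<xi>(1) \<xi>L] z by blast
  next
    fix z assume "z \<in> ?out ` solutions"
    then obtain L where z: "z = ?out L" and sol: "L \<in> solutions"
      by blast
    have LA: "L v \<in> A v" if "v \<in> V" for v
      using sol that unfolding solutions_def by blast
    define \<xi> where "\<xi> = map (\<lambda>v. vec (L v)) vs"
    have \<xi>: "length \<xi> = n" "\<And>i. i < n \<Longrightarrow> \<xi> ! i = vec (L (vs ! i))"
      by (auto simp: \<xi>_def n_def)
    have "\<xi> \<in> cyclic_transversals B"
      unfolding cyclic_transversals_def using sum_vec[of L] LA sol nth_V by (auto simp: len nthB \<xi>)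
    then show "z \<in> coord_proj J \<sigma> ` incidence_vector ` cyclic_transversals B"
      using proj[OF LA \<xi>] z by (metis image_eqI)
  qed
  have "inj_on \<sigma> J"
  proof (rule inj_onI)
    fix i j assume ij: "i \<in> J" "j \<in> J" "\<sigma> i = \<sigma> j"
    then have "idx (loc i) = idx (loc j)" "vec (pat i) = vec (pat j)"
      by (auto simp: \<sigma>_def)
    then have "loc i = loc j"
      using idx[of "loc i"] idx[of "loc j"] pat ij by metis
    moreover have "pat i = pat j"
      using vec_inj[OF \<open>vec (pat i) = vec (pat j)\<close>] sub pat ij by blast
    ultimately show "i = j"
      using inj ij by (auto dest: inj_onD)
  qed
  moreover have "\<sigma> ` J \<subseteq> ctp_coords B"
    using idx pat by (auto simp: \<sigma>_def ctp_coords_def len nthB)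
  moreover have "CTP B \<subseteq> coord_space (ctp_coords B)"
    unfolding CTP_def
    by (rule hull_minimal[where S = convex, OF _ convex_coord_space])
      (auto simp: coord_space_def ctp_coords_def incidence_vector_def cyclic_transversals_def)
  moreover have "coord_proj J \<sigma> ` CTP B = convex hull (?out ` solutions)"
    unfolding CTP_def convex_hull_linear_image[OF linear_coord_proj] img ..
  moreover have "convex hull (?out ` solutions) \<subseteq> coord_space J"
    by (rule hull_minimal[where S = convex, OF _ convex_coord_space]) (auto simp: coord_space_def)
  ultimately have "extension_by_coord_proj (ctp_coords B) (CTP B) J (convex hull (?out ` solutions))"
    unfolding extension_by_coord_proj_def by blast
  then show ?thesis
    using config size by blast
qed

end

section \<open>Computations as wirings\<close>

text \<open>
  The nodes form the space-time diagram of a run of length \<open>T\<close> on the tape cells from \<open>-w\<close> to \<open>w\<close>.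
  The node \<open>Head (Suc t)\<close> performs the step from time \<open>t\<close> to time \<open>t + 1\<close>, and \<open>Cell (Suc t) p\<close>
  transports the content of cell \<open>p\<close> through that step. The nodes with time index \<open>0\<close> and \<open>Suc T\<close>
  impose the initial and the final condition.
\<close>

datatype node = Head nat | Cell nat int

text \<open>
  The active wires at time \<open>t\<close> describe the configuration: \<open>Conf t q h\<close> says that the machine is in
  state \<open>q\<close> with its head on cell \<open>h\<close>, and \<open>Symb t p a\<close> that cell \<open>p\<close> contains \<open>a\<close>.
  The wire \<open>Write t p a b\<close> is the message from the head to cell \<open>p\<close> that, in the step leaving time \<open>t\<close>,
  the symbol \<open>a\<close> is read there and replaced by \<open>b\<close>.
\<close>

datatype 'a wire =
    Conf nat nat int
  | Symb nat int "'a tape_symbol"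
  | Write nat int "'a tape_symbol" "'a tape_symbol"

fun source :: "'a wire \<Rightarrow> node" where
  "source (Conf t q h) = Head t"
| "source (Symb t p a) = Cell t p"
| "source (Write t p a b) = Head (Suc t)"

fun target :: "'a wire \<Rightarrow> node" where
  "target (Conf t q h) = Head (Suc t)"
| "target (Symb t p a) = Cell (Suc t) p"
| "target (Write t p a b) = Cell (Suc t) p"

definition nodes :: "nat \<Rightarrow> nat \<Rightarrow> node set" where
  "nodes T w = Head ` {..Suc T} \<union> (\<lambda>(t, p). Cell t p) ` ({..Suc T} \<times> {- int w..int w})"

text \<open>
  A head node chooses a transition together with a head position, a cell node either copies its symbol
  or obeys a message. Agreement on the \<open>Write\<close> wires forces a cell to obey exactly when the head
  visits it, so no option has to involve more than one cell. This keeps the number of options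
  per node linear in \<open>w\<close>. At time \<open>0\<close> the content of cell \<open>p\<close> is a free choice from \<open>I p\<close>.
\<close>

fun choices ::
    "'a ntm \<Rightarrow> (int \<Rightarrow> 'a tape_symbol set) \<Rightarrow> nat \<Rightarrow> nat \<Rightarrow> node \<Rightarrow> 'a wire set set" where
  "choices M I T w (Head 0) = {{Conf 0 (ntm_start M) 0}}"
| "choices M I T w (Head (Suc t)) =
    (if t < T
     then (\<lambda>((q, a, q', b, s), h). {Conf t q h, Write t h a b, Conf (Suc t) q' (h + s)}) `
            (ntm_trans M \<times> {- int w..int w})
     else (\<lambda>h. {Conf T (ntm_accept M) h}) ` {- int w..int w})"
| "choices M I T w (Cell 0 p) = (\<lambda>a. {Symb 0 p a}) ` I p"
| "choices M I T w (Cell (Suc t) p) =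
    (if t < T
     then (\<lambda>a. {Symb t p a, Symb (Suc t) p a}) ` ntm_symbols M \<union>
          (\<lambda>(a, b). {Symb t p a, Write t p a b, Symb (Suc t) p b}) ` (ntm_symbols M \<times> ntm_symbols M)
     else (\<lambda>a. {Symb T p a}) ` ntm_symbols M)"

text \<open>
  The head starts on cell \<open>0\<close> and moves by at most one cell per step. With \<open>T \<le> w\<close> it therefore stays
  on the cells of the diagram throughout the run.
\<close>

locale tableau =
  fixes M :: "'a::finite ntm" and I :: "int \<Rightarrow> 'a tape_symbol set" and T w :: nat
  assumes wf: "wf_ntm M" and trans_nonempty: "ntm_trans M \<noteq> {}"
    and I_nonempty: "I p \<noteq> {}" and I_symbols: "I p \<subseteq> ntm_symbols M"
    and wide: "T \<le> w"
begin

lemma finite_symbols: "finite (ntm_symbols M)"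
  and finite_trans: "finite (ntm_trans M)"
  and trans_sub: "ntm_trans M \<subseteq>
       ntm_states M \<times> ntm_symbols M \<times> ntm_states M \<times> ntm_symbols M \<times> {-1, 0, 1}"
  and symbols_nonempty: "ntm_symbols M \<noteq> {}"
proof -
  show sub: "ntm_trans M \<subseteq>
       ntm_states M \<times> ntm_symbols M \<times> ntm_states M \<times> ntm_symbols M \<times> {-1, 0, 1}"
    using wf by (simp add: wf_ntm_def)
  show "finite (ntm_symbols M)" "ntm_symbols M \<noteq> {}"
    using wf by (auto simp: wf_ntm_def)
  then show "finite (ntm_trans M)"
    using wf by (intro finite_subset[OF sub]) (auto simp: wf_ntm_def)
qed

lemma finite_I: "finite (I p)"
  using finite_subset[OF I_symbols finite_symbols] .

lemma node_cases:
  assumes "v \<in> nodes T w"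
  obtains "v = Head 0"
  | t where "v = Head (Suc t)" "t \<le> T"
  | p where "v = Cell 0 p" "p \<in> {- int w..int w}"
  | t p where "v = Cell (Suc t) p" "t \<le> T" "p \<in> {- int w..int w}"
proof (cases v)
  case (Head t)
  then show ?thesis
    using assms that(1,2) by (cases t) (auto simp: nodes_def)
next
  case (Cell t p)
  then show ?thesis
    using assms that(3,4) by (cases t) (auto simp: nodes_def)
qed

lemma Head_in_nodes [simp]: "Head t \<in> nodes T w \<longleftrightarrow> t \<le> Suc T"
  and Cell_in_nodes [simp]: "Cell t p \<in> nodes T w \<longleftrightarrow> t \<le> Suc T \<and> p \<in> {- int w..int w}"
  by (auto simp: nodes_def)

sublocale wiring "nodes T w" "choices M I T w" source target
proof
  show "finite (nodes T w)"
    by (auto simp: nodes_def)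
  have "card {Head 0, Head 1} \<le> card (nodes T w)"
    by (intro card_mono) (auto simp: nodes_def)
  then show "2 \<le> card (nodes T w)"
    by simp
next
  fix v assume v: "v \<in> nodes T w"
  then show "finite (choices M I T w v)"
    by (cases rule: node_cases) (auto simp: finite_symbols finite_trans finite_I)
  show "choices M I T w v \<noteq> {}"
    using v by (cases rule: node_cases) (auto simp: trans_nonempty symbols_nonempty I_nonempty)
  fix S assume S: "S \<in> choices M I T w v"
  show "finite S"
    using v S by (cases rule: node_cases) (auto split: if_splits)
  fix k assume k: "k \<in> S"
  show "v = source k \<or> v = target k"
    using v S k by (cases rule: node_cases) (auto split: if_splits)
  show "source k \<in> nodes T w \<and> target k \<in> nodes T w \<and> source k \<noteq> target k"
    using v S k by (cases rule: node_cases) (auto split: if_splits)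
qed

text \<open>
  Induction along the time axis: a solution determines at each time one state and head position, and
  the wires \<open>Symb t p a\<close> agree with the tape of an actual run. Cells outside the diagram are never
  visited, hence the initial tape may be arbitrary there.
\<close>

lemma run_of_solution:
  assumes L: "L \<in> solutions"
    and tape: "\<And>p. p \<in> {- int w..int w} \<Longrightarrow> L (Cell 0 p) = {Symb 0 p (\<tau>0 p)}"
  shows "\<exists>\<tau> h. (ntm_step M ^^ T) (ntm_start M, \<tau>0, 0) (ntm_accept M, \<tau>, h)"
proof -
  have choice: "L v \<in> choices M I T w v" if "v \<in> nodes T w" for v
    using L that by (auto simp: solutions_def)
  have src: "k \<in> L (source k)" if "v \<in> nodes T w" "k \<in> L v" for v k
    using L that by (auto simp: solutions_def)
  have tgt: "k \<in> L (target k)" if "v \<in> nodes T w" "k \<in> L v" for v k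
    using L that by (auto simp: solutions_def)
  have run: "\<exists>q \<tau> h. (ntm_step M ^^ t) (ntm_start M, \<tau>0, 0) (q, \<tau>, h) \<and>
      (\<forall>q' h'. Conf t q' h' \<in> L (Head t) \<longrightarrow> q' = q \<and> h' = h) \<and>
      (\<forall>p\<in>{- int w..int w}. \<forall>a. Symb t p a \<in> L (Cell t p) \<longrightarrow> a = \<tau> p)" if "t \<le> T" for t
    using that
  proof (induction t)
    case 0
    then show ?case
      using choice[of "Head 0"] tape by auto
  next
    case (Suc t)
    from Suc.IH[OF Suc_leD[OF Suc.prems]] obtain q \<tau> h where IH: "(ntm_step M ^^ t) (ntm_start M, \<tau>0, 0) (q, \<tau>, h)"
      "\<And>q' h'. Conf t q' h' \<in> L (Head t) \<Longrightarrow> q' = q \<and> h' = h"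
      "\<And>p a. p \<in> {- int w..int w} \<Longrightarrow> Symb t p a \<in> L (Cell t p) \<Longrightarrow> a = \<tau> p"
      by auto
    have t: "t < T"
      using Suc by simp
    obtain q1 a q' b s h1 where tr: "(q1, a, q', b, s) \<in> ntm_trans M" and h1: "h1 \<in> {- int w..int w}"
      and LH: "L (Head (Suc t)) = {Conf t q1 h1, Write t h1 a b, Conf (Suc t) q' (h1 + s)}"
      using choice[of "Head (Suc t)"] t by auto
    \<comment> \<open>The incoming configuration wire must also be active at the previous head node.\<close>
    have q1: "q1 = q" "h1 = h"
      using IH(2)[of q1 h1] src[of "Head (Suc t)" "Conf t q1 h1"] t by (auto simp: LH)
    \<comment> \<open>The message is delivered, so the cell under the head cannot have chosen to copy.\<close>
    have W: "Write t h a b \<in> L (Cell (Suc t) h)"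
      using tgt[of "Head (Suc t)" "Write t h a b"] t by (auto simp: LH q1)
    have LC: "L (Cell (Suc t) h) = {Symb t h a, Write t h a b, Symb (Suc t) h b}"
    proof -
      from choice[of "Cell (Suc t) h"] t h1
      have "(\<exists>c. L (Cell (Suc t) h) = {Symb t h c, Symb (Suc t) h c}) \<or>
          (\<exists>c d. L (Cell (Suc t) h) = {Symb t h c, Write t h c d, Symb (Suc t) h d})"
        unfolding q1 by auto
      with W show ?thesis
        by (elim disjE exE) simp_all
    qed
    have a: "a = \<tau> h"
      using src[of "Cell (Suc t) h" "Symb t h a"] IH(3)[of h a] h1 t by (auto simp: LC q1)
    have step: "ntm_step M (q, \<tau>, h) (q', \<tau>(h := b), h + s)"
      using tr by (auto simp: ntm_step_def q1 a)
    have tape': "c = (\<tau>(h := b)) p" if p: "p \<in> {- int w..int w}" and c: "Symb (Suc t) p c \<in> L (Cell (Suc t) p)"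
      for p c
    proof (cases "p = h")
      case True
      then show ?thesis
        using c by (auto simp: LC)
    next
      case False
      \<comment> \<open>No message is sent to the other cells, so they can only copy.\<close>
      have "Write t p x y \<notin> L (Cell (Suc t) p)" for x y
        using src[of "Cell (Suc t) p" "Write t p x y"] t p False by (auto simp: LH q1)
      then have "L (Cell (Suc t) p) = {Symb t p c, Symb (Suc t) p c}"
        using choice[of "Cell (Suc t) p"] c t p by auto
      then show ?thesis
        using src[of "Cell (Suc t) p" "Symb t p c"] IH(3)[of p c] t p False by auto
    qed
    have head': "q'' = q' \<and> h'' = h + s" if "Conf (Suc t) q'' h'' \<in> L (Head (Suc t))" for q'' h''
      using that by (auto simp: LH q1)
    show ?case
      using relpowp_Suc_I[OF IH(1) step] head' tape' by blast
  qed
  obtain h' where "L (Head (Suc T)) = {Conf T (ntm_accept M) h'}"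
    using choice[of "Head (Suc T)"] by auto
  then have "Conf T (ntm_accept M) h' \<in> L (Head T)"
    using src[of "Head (Suc T)" "Conf T (ntm_accept M) h'"] by simp
  then show ?thesis
    using run[of T] by auto
qed

text \<open>
  Activate the wires that describe the run and let every node choose all active wires incident
  to it. The two ends of a wire then agree by construction, and it remains to see that these choices
  are options of the nodes.
\<close>

lemma solution_of_run:
  assumes run: "(ntm_step M ^^ T) (ntm_start M, \<tau>0, 0) (ntm_accept M, \<tau>1, h1)"
    and tape: "\<And>p. \<tau>0 p \<in> I p"
  shows "\<exists>L\<in>solutions. \<forall>p\<in>{- int w..int w}. L (Cell 0 p) = {Symb 0 p (\<tau>0 p)}"
proof -
  obtain c where c: "c 0 = (ntm_start M, \<tau>0, 0)" "c T = (ntm_accept M, \<tau>1, h1)"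
    "\<And>t. t < T \<Longrightarrow> ntm_step M (c t) (c (Suc t))"
    using run unfolding relpowp_fun_conv by blast
  define q \<tau> h where "q t = fst (c t)" and "\<tau> t = fst (snd (c t))" and "h t = snd (snd (c t))" for t
  have c_eq: "c t = (q t, \<tau> t, h t)" for t
    by (simp add: q_def \<tau>_def h_def)
  have init: "q 0 = ntm_start M" "\<tau> 0 = \<tau>0" "h 0 = 0" "q T = ntm_accept M"
    using c(1,2) by (auto simp: c_eq)
  have step: "(q t, \<tau> t (h t), q (Suc t), \<tau> (Suc t) (h t), h (Suc t) - h t) \<in> ntm_trans M"
    and frame: "\<And>p. p \<noteq> h t \<Longrightarrow> \<tau> (Suc t) p = \<tau> t p" if "t < T" for t
    using c(3)[OF that] by (auto simp: c_eq ntm_step_def)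
  have h_bound: "\<bar>h t\<bar> \<le> int t" if "t \<le> T" for t
    using that
  proof (induction t)
    case (Suc t)
    then show ?case
      using step[of t] trans_sub by auto
  qed (simp add: init)
  have h_range: "h t \<in> {- int w..int w}" if "t \<le> T" for t
    using h_bound[OF that] that wide by (simp add: abs_le_iff)
  have symbols: "\<tau> t p \<in> ntm_symbols M" if "t \<le> T" for t p
    using that
  proof (induction t)
    case 0
    then show ?case
      using tape I_symbols by (auto simp: init)
  next
    case (Suc t)
    then show ?case
      using step[of t] frame[of t p] trans_sub by (cases "p = h t") auto
  qed
  define K where "K = {Conf t (q t) (h t) |t. t \<le> T} \<union> {Symb t p (\<tau> t p) |t p. t \<le> T} \<union>
    {Write t (h t) (\<tau> t (h t)) (\<tau> (Suc t) (h t)) |t. t < T}"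
  define L where "L v = {k \<in> K. source k = v \<or> target k = v}" for v
  have "L v \<in> choices M I T w v" if "v \<in> nodes T w" for v
    using that
  proof (cases rule: node_cases)
    case 1
    have "L (Head 0) = {Conf 0 (q 0) (h 0)}"
      by (auto simp: L_def K_def)
    then show ?thesis
      by (simp add: 1 init)
  next
    case (2 t)
    show ?thesis
    proof (cases "t < T")
      case True
      then have "L (Head (Suc t)) = {Conf t (q t) (h t), Write t (h t) (\<tau> t (h t)) (\<tau> (Suc t) (h t)),
          Conf (Suc t) (q (Suc t)) (h t + (h (Suc t) - h t))}"
        by (auto simp: L_def K_def)
      then show ?thesis
        unfolding 2 choices.simps using True step[OF True] h_range[of t]
        by (simp only: if_True) (rule image_eqI[of _ _ "(_, h t)"]; simp)
    next
      case False
      then have "t = T"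
        using 2 by simp
      moreover have "L (Head (Suc T)) = {Conf T (q T) (h T)}"
        by (auto simp: L_def K_def)
      ultimately show ?thesis
        using h_range[of T] by (simp add: 2 init)
    qed
  next
    case (3 p)
    have "L (Cell 0 p) = {Symb 0 p (\<tau> 0 p)}"
      by (auto simp: L_def K_def)
    then show ?thesis
      using tape by (simp add: 3 init)
  next
    case (4 t p)
    consider "t < T" "p = h t" | "t < T" "p \<noteq> h t" | "t = T"
      using 4 by linarith
    then show ?thesis
    proof cases
      case 1
      then have "L (Cell (Suc t) p) = {Symb t p (\<tau> t p), Write t p (\<tau> t p) (\<tau> (Suc t) p),
          Symb (Suc t) p (\<tau> (Suc t) p)}"
        by (auto simp: L_def K_def)
      then show ?thesis
        using 1 symbols[of t p] symbols[of "Suc t" p] by (auto simp: 4)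
    next
      case 2
      then have "L (Cell (Suc t) p) = {Symb t p (\<tau> t p), Symb (Suc t) p (\<tau> t p)}"
        using frame by (auto simp: L_def K_def)
      then show ?thesis
        using 2 symbols[of t p] by (auto simp: 4)
    next
      case 3
      then have "L (Cell (Suc t) p) = {Symb T p (\<tau> T p)}"
        by (auto simp: L_def K_def)
      then show ?thesis
        using 3 symbols[of T p] by (auto simp: 4)
    qed
  qed
  then have "L \<in> solutions"
    by (auto simp: solutions_def L_def)
  moreover have "L (Cell 0 p) = {Symb 0 p (\<tau>0 p)}" for p
    by (auto simp: L_def K_def init)
  ultimately show ?thesis
    by blast
qed

lemma sum_card_choices:
  "(\<Sum>v\<in>nodes T w. card (choices M I T w v)) \<le>
     2 * (card (ntm_trans M) + card (ntm_symbols M) + (card (ntm_symbols M))\<^sup>2 + 1) * (2 * w + 1) * (T + 2)"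
proof -
  define D where "D = card (ntm_trans M) + card (ntm_symbols M) + (card (ntm_symbols M))\<^sup>2 + 1"
  have width: "card {- int w..int w} = 2 * w + 1"
    by (simp add: nat_add_distrib nat_mult_distrib)
  have head: "card (choices M I T w (Head t)) \<le> D * (2 * w + 1)" for t
  proof (cases t)
    case (Suc t')
    have "card (choices M I T w (Head t)) \<le> card (ntm_trans M) * (2 * w + 1) + (2 * w + 1)"
    proof (cases "t' < T")
      case True
      then show ?thesis
        unfolding Suc choices.simps width[symmetric] card_cartesian_product[symmetric]
        by (simp only: if_True) (intro trans_le_add1 card_image_le finite_cartesian_product finite_trans; simp)
    next
      case False
      then show ?thesis
        unfolding Suc choices.simps width[symmetric]
        by (simp only: if_False) (intro trans_le_add2 card_image_le; simp)
    qed
    also have "\<dots> \<le> D * (2 * w + 1)"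
      by (simp add: D_def algebra_simps)
    finally show ?thesis .
  qed (simp add: D_def)
  have cell: "card (choices M I T w (Cell t p)) \<le> D" for t p
  proof (cases t)
    case 0
    then show ?thesis
      using card_image_le[OF finite_I, of "\<lambda>a. {Symb 0 p a}" p] card_mono[OF finite_symbols I_symbols, of p]
      by (simp add: D_def)
  next
    case (Suc t')
    have 1: "card (f ` ntm_symbols M) \<le> card (ntm_symbols M)" for f :: "_ \<Rightarrow> 'a wire set"
      by (rule card_image_le[OF finite_symbols])
    have 2: "card (f ` (ntm_symbols M \<times> ntm_symbols M)) \<le> (card (ntm_symbols M))\<^sup>2"
      for f :: "_ \<Rightarrow> 'a wire set"
      using card_image_le[of "ntm_symbols M \<times> ntm_symbols M" f]
      by (simp add: finite_symbols card_cartesian_product power2_eq_square)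
    have 3: "card (f ` ntm_symbols M \<union> g ` (ntm_symbols M \<times> ntm_symbols M)) \<le> D"
      for f g :: "_ \<Rightarrow> 'a wire set"
      using card_Un_le[of "f ` ntm_symbols M" "g ` (ntm_symbols M \<times> ntm_symbols M)"] 1[of f] 2[of g]
      unfolding D_def by linarith
    show ?thesis
      using 1[of "\<lambda>a. {Symb T p a}"] 3 by (simp add: Suc D_def)
  qed
  have "(\<Sum>v\<in>nodes T w. card (choices M I T w v)) =
      (\<Sum>v\<in>Head ` {..Suc T}. card (choices M I T w v)) +
      (\<Sum>v\<in>(\<lambda>(t, p). Cell t p) ` ({..Suc T} \<times> {- int w..int w}). card (choices M I T w v))"
    unfolding nodes_def by (intro sum.union_disjoint) auto
  also have "\<dots> \<le> card (Head ` {..Suc T}) * (D * (2 * w + 1)) +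
      card ((\<lambda>(t, p). Cell t p) ` ({..Suc T} \<times> {- int w..int w})) * D"
    using head cell
    by (intro add_mono sum_bounded_above[where 'a = nat, simplified]) auto
  also have "\<dots> \<le> (T + 2) * (D * (2 * w + 1)) + ((T + 2) * (2 * w + 1)) * D"
    using card_image_le[of "{..Suc T}" Head]
      card_image_le[of "{..Suc T} \<times> {- int w..int w}" "\<lambda>(t, p). Cell t p"]
    by (intro add_mono mult_right_mono) (simp_all only: card_cartesian_product width card_atMost
        finite_cartesian_product finite_atMost finite_atLeastAtMost_int add_2_eq_Suc')
  also have "\<dots> = 2 * D * (2 * w + 1) * (T + 2)"
    by (simp add: algebra_simps)
  finally show ?thesis
    unfolding D_def .
qed

end

section \<open>Idle steps\<close>

text \<open>
  The diagram has a fixed number of steps, whereas accepting runs only have a bounded length. Idle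
  transitions, which change nothing, make it possible to pad a run.
\<close>

definition add_idle :: "'a ntm \<Rightarrow> 'a ntm" where
  "add_idle M =
     M\<lparr>ntm_trans := ntm_trans M \<union> {(q, a, q, a, 0) |q a. q \<in> ntm_states M \<and> a \<in> ntm_symbols M}\<rparr>"

lemma add_idle_simps [simp]:
  "ntm_start (add_idle M) = ntm_start M" "ntm_accept (add_idle M) = ntm_accept M"
  "ntm_states (add_idle M) = ntm_states M" "ntm_symbols (add_idle M) = ntm_symbols M"
  "ntm_trans (add_idle M) =
     ntm_trans M \<union> {(q, a, q, a, 0) |q a. q \<in> ntm_states M \<and> a \<in> ntm_symbols M}"
  by (simp_all add: add_idle_def)

lemma wf_add_idle: "wf_ntm M \<Longrightarrow> wf_ntm (add_idle M)"
  by (auto simp: wf_ntm_def)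

lemma add_idle_trans_nonempty: "wf_ntm M \<Longrightarrow> ntm_trans (add_idle M) \<noteq> {}"
  by (auto simp: wf_ntm_def)

definition input_tape :: "'a list \<Rightarrow> int \<Rightarrow> 'a tape_symbol" where
  "input_tape u = (\<lambda>p. if 0 \<le> p \<and> p < int (length u) then Input (u ! nat p) else Blank)"

lemma initial_config_eq: "initial_config M u = (ntm_start M, input_tape u, 0)"
  by (simp add: initial_config_def input_tape_def)

lemma input_tape_symbols: "wf_ntm M \<Longrightarrow> input_tape u p \<in> ntm_symbols M"
  by (auto simp: wf_ntm_def input_tape_def)

text \<open>
  Deleting the idle steps of a run leaves a run of the original machine; conversely, a short run can be
  padded by waiting in the initial configuration.
\<close>

lemma accepts_in_add_idle_iff:
  assumes wf: "wf_ntm M"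
  shows "accepts_in (add_idle M) u T \<longleftrightarrow> (\<exists>t\<le>T. accepts_in M u t)"
proof
  have step: "c' = c \<or> ntm_step M c c'" if "ntm_step (add_idle M) c c'" for c c'
    using that by (auto simp: ntm_step_def)
  have "\<exists>t\<le>T. (ntm_step M ^^ t) c c'" if "(ntm_step (add_idle M) ^^ T) c c'" for c c'
    using that
  proof (induction T arbitrary: c')
    case (Suc T)
    obtain c1 where c1: "(ntm_step (add_idle M) ^^ T) c c1" "ntm_step (add_idle M) c1 c'"
      using Suc.prems by (rule relpowp_Suc_E)
    obtain t where "t \<le> T" "(ntm_step M ^^ t) c c1"
      using Suc.IH[OF c1(1)] by blast
    then show ?case
      using step[OF c1(2)] relpowp_Suc_I[of t "ntm_step M" c c1 c']
      by (metis Suc_le_mono le_SucI)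
  qed auto
  then show "accepts_in (add_idle M) u T \<Longrightarrow> \<exists>t\<le>T. accepts_in M u t"
    unfolding accepts_in_def by (fastforce simp: initial_config_def)
next
  assume "\<exists>t\<le>T. accepts_in M u t"
  then obtain t \<tau> h where t: "t \<le> T"
    and run: "(ntm_step M ^^ t) (initial_config M u) (ntm_accept M, \<tau>, h)"
    by (auto simp: accepts_in_def)
  have init: "initial_config (add_idle M) u = initial_config M u"
    by (simp add: initial_config_def)
  have "ntm_step (add_idle M) (initial_config M u) (initial_config M u)"
    using wf input_tape_symbols[OF wf, of u 0]
    by (auto simp: ntm_step_def initial_config_eq wf_ntm_def)
  then have idle: "(ntm_step (add_idle M) ^^ n) (initial_config M u) (initial_config M u)" for n
    by (induction n) (auto intro: relcomppI)
  have "(ntm_step (add_idle M) ^^ t) (initial_config M u) (ntm_accept M, \<tau>, h)"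
    using run by (rule relpowp_mono[rotated]) (auto simp: ntm_step_def)
  then have "(ntm_step (add_idle M) ^^ (T - t + t)) (initial_config M u) (ntm_accept M, \<tau>, h)"
    unfolding relpowp_add using idle by blast
  then show "accepts_in (add_idle M) u T"
    using t by (auto simp: accepts_in_def init)
qed

section \<open>Polynomial bounds\<close>

text \<open>
  A time bound is given in terms of the length of the whole input word, for which only an upper bound
  is known. Substituting that upper bound requires a monotone polynomial, which is obtained by
  replacing all coefficients with their absolute values.
\<close>

lemma monotone_poly_bound:
  fixes p :: "real poly"
  shows "\<exists>r :: real poly. \<forall>x\<ge>0. 0 \<le> poly r x \<and> poly p x \<le> poly r x \<and> (\<forall>z\<ge>x. poly r x \<le> poly r z)"
proof (induction p)
  case 0
  then show ?case
    by (intro exI[of _ 0]) simp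
next
  case (pCons a p)
  then obtain r :: "real poly"
    where r: "\<forall>x\<ge>0. 0 \<le> poly r x \<and> poly p x \<le> poly r x \<and> (\<forall>z\<ge>x. poly r x \<le> poly r z)"
    by blast
  have "0 \<le> poly (pCons \<bar>a\<bar> r) x \<and> poly (pCons a p) x \<le> poly (pCons \<bar>a\<bar> r) x \<and>
      (\<forall>z\<ge>x. poly (pCons \<bar>a\<bar> r) x \<le> poly (pCons \<bar>a\<bar> r) z)" if "x \<ge> 0" for x
    using r that by (auto intro!: add_mono mult_left_mono mult_mono)
  then show ?case
    by blast
qed

section \<open>Cyclic transversal polytopes express NP\<close>

lemma length_pair_word: "length (pair_word y x) = length y + 1 + length x"
  by (simp add: pair_word_def)

lemma nth_pair_word:
  assumes "i < length y + 1 + length x"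
  shows "pair_word y x ! i =
    (if i < length y then Some (y ! i) else if i = length y then None else Some (x ! (i - Suc (length y))))"
proof -
  have "i - length y = Suc (i - Suc (length y))" if "i > length y"
    using that by simp
  then show ?thesis
    using assms by (auto simp: pair_word_def nth_append nth_Cons')
qed

text \<open>
  The first occurrence of the separator marks the end of the first component.
\<close>

lemma pair_word_inject:
  assumes eq: "pair_word y x = pair_word y' x'"
  shows "y = y' \<and> x = x'"
proof -
  have "takeWhile (\<lambda>a. a \<noteq> None) (pair_word y x) = map Some y" for y x
    by (simp add: pair_word_def takeWhile_append)
  then have "map Some y = map Some y'"
    using eq by metis
  then have "y = y'"
    by (simp add: inj_map_eq_map)
  then show ?thesis
    using eq by (simp add: pair_word_def inj_map_eq_map)
qed

text \<open>
  On the cells behind the separator, the initial content is a free choice between the two bits, and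
  everywhere else it is determined by \<open>y\<close>. Solutions of the diagram are thus accepting runs on words
  \<open>pair_word y x\<close> with a guessed \<open>x\<close>, and the \<open>j\<close>-th bit of \<open>x\<close> is 1 iff the cell holding it chooses the
  symbol \<open>Input (Some True)\<close> at time \<open>0\<close>.
\<close>

lemma block_configuration_of_bounded_computation:
  fixes M :: "bool option ntm"
  assumes wfM: "wf_ntm M"
  shows "\<exists>d B. block_configuration d B \<and>
    config_size B \<le> 2 * (card (ntm_trans (add_idle M)) + card (ntm_symbols M) + (card (ntm_symbols M))\<^sup>2 + 1) *
      (2 * (T + (length y + 1 + l)) + 1) * (T + 2) \<and>
    extension_by_coord_proj (ctp_coords B) (CTP B) {..<l}
      (polytope01 {x. length x = l \<and> (\<exists>t\<le>T. accepts_in M (pair_word y x) t)})"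
proof -
  define w where "w = T + (length y + 1 + l)"
  define I where "I p = (\<lambda>x. input_tape (pair_word y x) p) ` {x. length x = l}" for p
  define X where "X = {x. length x = l \<and> (\<exists>t\<le>T. accepts_in M (pair_word y x) t)}"
  interpret tableau "add_idle M" I T w
  proof
    show "I p \<noteq> {}" for p
      using Ex_list_of_length by (auto simp: I_def)
    show "I p \<subseteq> ntm_symbols (add_idle M)" for p
      by (auto simp: I_def input_tape_symbols[OF wfM])
  qed (use wf_add_idle[OF wfM] add_idle_trans_nonempty[OF wfM] in \<open>auto simp: w_def\<close>)
  define pos where "pos j = int (length y + 1 + j)" for j
  define loc where "loc j = Cell 0 (pos j)" for j
  define pat :: "nat \<Rightarrow> bool option wire set" where "pat j = {Symb 0 (pos j) (Input (Some True))}" for j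
  have pos: "input_tape (pair_word y x) (pos j) = Input (Some (x ! j))" if "length x = l" "j < l" for x j
    using that by (simp add: input_tape_def pos_def length_pair_word nth_pair_word nat_add_distrib nat_int_add)
  have other: "input_tape (pair_word y x) p = input_tape (pair_word y x') p"
    if "length x = l" "length x' = l" "p \<notin> pos ` {..<l}" for x x' p
  proof (cases "0 \<le> p \<and> p < int (length y + 1 + l)")
    case True
    then obtain i where i: "p = int i" "i < length y + 1 + l"
      using nonneg_int_cases by (metis of_nat_less_iff)
    have "i \<le> length y"
    proof (rule ccontr)
      assume "\<not> i \<le> length y"
      then have "p = pos (i - Suc (length y))" "i - Suc (length y) < l"
        using i by (auto simp: pos_def)
      then show False
        using that(3) by blast
    qed
    then show ?thesis
      using i that by (simp add: input_tape_def length_pair_word nth_pair_word)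
  next
    case False
    then show ?thesis
      using that by (auto simp: input_tape_def length_pair_word)
  qed
  have pos_range: "pos j \<in> {- int w..int w}" if "j < l" for j
    using that by (auto simp: pos_def w_def)
  have accept: "length x = l \<Longrightarrow> x \<in> X \<longleftrightarrow> (\<exists>\<tau> h. (ntm_step (add_idle M) ^^ T)
      (ntm_start (add_idle M), input_tape (pair_word y x), 0) (ntm_accept (add_idle M), \<tau>, h))" for x
    using accepts_in_add_idle_iff[OF wfM, of "pair_word y x" T]
    by (simp add: X_def accepts_in_def initial_config_eq)
  let ?out = "\<lambda>L j. of_bool (j \<in> {..<l} \<and> L (loc j) = pat j) :: real"
  have out: "?out L = vec01 x"
    if "length x = l" "\<And>j. j < l \<Longrightarrow> L (loc j) = {Symb 0 (pos j) (input_tape (pair_word y x) (pos j))}" for L x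
    using that by (auto simp: vec01_def pat_def pos fun_eq_iff)
  have img: "?out ` solutions = vec01 ` X"
  proof (intro equalityI subsetI)
    fix z assume "z \<in> ?out ` solutions"
    then obtain L where L: "L \<in> solutions" and z: "z = ?out L"
      by blast
    define x where "x = map (\<lambda>j. L (loc j) = pat j) [0..<l]"
    have x: "length x = l" "\<And>j. j < l \<Longrightarrow> x ! j \<longleftrightarrow> L (loc j) = pat j"
      by (auto simp: x_def)
    have tape: "L (Cell 0 p) = {Symb 0 p (input_tape (pair_word y x) p)}" if p: "p \<in> {- int w..int w}" for p
    proof -
      have "L (Cell 0 p) \<in> choices (add_idle M) I T w (Cell 0 p)"
        using L p unfolding solutions_def by (auto simp del: choices.simps)
      then obtain x' where x': "length x' = l" "L (Cell 0 p) = {Symb 0 p (input_tape (pair_word y x') p)}"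
        by (auto simp: I_def)
      show ?thesis
      proof (cases "p \<in> pos ` {..<l}")
        case True
        then obtain j where j: "p = pos j" "j < l"
          by auto
        have "x ! j = x' ! j"
          using x(2)[OF j(2)] x' j by (simp add: loc_def pat_def pos)
        then show ?thesis
          using x' x(1) j by (simp add: pos)
      next
        case False
        then show ?thesis
          using x' other[OF x'(1) x(1)] by simp
      qed
    qed
    have "x \<in> X"
      using run_of_solution[OF L tape] accept[OF x(1)] by blast
    moreover have "z = vec01 x"
      unfolding z by (rule out[OF x(1)]) (simp add: loc_def tape pos_range del: atLeastAtMost_iff)
    ultimately show "z \<in> vec01 ` X"
      by blast
  next
    fix z assume "z \<in> vec01 ` X"
    then obtain x where x: "x \<in> X" and z: "z = vec01 x"
      by blast
    have len: "length x = l"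
      using x by (simp add: X_def)
    obtain \<tau> h where "(ntm_step (add_idle M) ^^ T)
      (ntm_start (add_idle M), input_tape (pair_word y x), 0) (ntm_accept (add_idle M), \<tau>, h)"
      using accept[OF len] x by blast
    from solution_of_run[OF this] len obtain L where L: "L \<in> solutions"
      "\<And>p. p \<in> {- int w..int w} \<Longrightarrow> L (Cell 0 p) = {Symb 0 p (input_tape (pair_word y x) p)}"
      by (auto simp: I_def)
    have "?out L = vec01 x"
      by (rule out[OF len]) (simp add: loc_def L(2) pos_range del: atLeastAtMost_iff)
    then show "z \<in> ?out ` solutions"
      unfolding z by (intro image_eqI[OF _ L(1)]) (rule sym)
  qed
  have inj: "inj_on (\<lambda>j. (loc j, pat j)) {..<l}"
    by (auto simp: inj_on_def loc_def pos_def)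
  have pat: "\<forall>j\<in>{..<l}. loc j \<in> nodes T w \<and> pat j \<in> choices (add_idle M) I T w (loc j)"
  proof
    fix j assume j: "j \<in> {..<l}"
    have "Input (Some True) = input_tape (pair_word y (replicate l True)) (pos j)"
      using j by (simp add: pos)
    then have "Input (Some True) \<in> I (pos j)"
      unfolding I_def by (rule image_eqI) simp
    then show "loc j \<in> nodes T w \<and> pat j \<in> choices (add_idle M) I T w (loc j)"
      using j pos_range[of j] by (simp add: loc_def pat_def)
  qed
  obtain d B where config: "block_configuration d B"
    and size: "config_size B \<le> (\<Sum>v\<in>nodes T w. card (choices (add_idle M) I T w v))"
    and ext: "extension_by_coord_proj (ctp_coords B) (CTP B) {..<l} (convex hull (vec01 ` X))"
    using block_configuration_of_wiring[OF inj pat, unfolded img] by (elim exE conjE)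
  have "config_size B \<le> 2 * (card (ntm_trans (add_idle M)) + card (ntm_symbols M) +
      (card (ntm_symbols M))\<^sup>2 + 1) * (2 * w + 1) * (T + 2)"
    using order_trans[OF size sum_card_choices] by (simp only: add_idle_simps)
  with config ext show ?thesis
    unfolding X_def w_def polytope01_def by (intro exI conjI)
qed

text \<open>
  The number of steps is chosen as the value of a monotone time bound at the length of the input word,
  so that the diagram captures all members of \<open>X y\<close>. The polynomial \<open>n\<close> bounds the length of
  the word, \<open>s\<close> the number of steps, and \<open>D\<close> collects the constants that depend on the machine only.
\<close>

theorem theorem3p6:
  fixes Y :: "bool list set"
    and m :: "bool list \<Rightarrow> nat"
    and X :: "bool list \<Rightarrow> bool list set"
  assumes "well_encoded Y m X"
  shows "\<exists>g :: real poly. \<forall>y\<in>Y. \<exists>d B.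
           block_configuration d B \<and>
           real (config_size B) \<le> poly g (real (length y)) \<and>
           extension_by_coord_proj (ctp_coords B) (CTP B) {..<m y} (polytope01 (X y))"
proof -
  have X: "\<And>y x. y \<in> Y \<Longrightarrow> x \<in> X y \<Longrightarrow> length x = m y"
    using assms by (auto simp: well_encoded_def)
  obtain f :: "real poly" where f: "\<And>y. y \<in> Y \<Longrightarrow> real (m y) \<le> poly f (real (length y))"
    using assms by (auto simp: well_encoded_def)
  obtain M and p :: "real poly" where wf: "wf_ntm M"
    and lang: "ntm_language M = {pair_word y x | y x. y \<in> Y \<and> x \<in> X y}"
    and p: "\<forall>u\<in>ntm_language M. \<exists>t. real t \<le> poly p (real (length u)) \<and> accepts_in M u t"
  proof -
    have "{pair_word y x | y x. y \<in> Y \<and> x \<in> X y} \<in> NP"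
      using assms by (simp add: well_encoded_def)
    then obtain M and p :: "real poly"
      where "wf_ntm M \<and> ntm_language M = {pair_word y x | y x. y \<in> Y \<and> x \<in> X y} \<and>
        (\<forall>u\<in>{pair_word y x | y x. y \<in> Y \<and> x \<in> X y}.
           \<exists>t. real t \<le> poly p (real (length u)) \<and> accepts_in M u t)"
      unfolding NP_def mem_Collect_eq by (elim exE)
    then show ?thesis
      using that[of M p] by simp
  qed
  obtain r :: "real poly" where r:
    "\<And>x. 0 \<le> x \<Longrightarrow> 0 \<le> poly r x" "\<And>x. 0 \<le> x \<Longrightarrow> poly p x \<le> poly r x"
    "\<And>x z. 0 \<le> x \<Longrightarrow> x \<le> z \<Longrightarrow> poly r x \<le> poly r z"
    using monotone_poly_bound[of p] by blast
  define D where "D = 2 * (card (ntm_trans (add_idle M)) + card (ntm_symbols M) + (card (ntm_symbols M))\<^sup>2 + 1)"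
  define n where "n = [:1, 1:] + f"
  define s where "s = pcompose r n + 1"
  define g where "g = smult (real D) ((smult 2 (s + n) + 1) * (s + 2))"
  have "\<exists>d B. block_configuration d B \<and> real (config_size B) \<le> poly g (real (length y)) \<and>
      extension_by_coord_proj (ctp_coords B) (CTP B) {..<m y} (polytope01 (X y))" if y: "y \<in> Y" for y
  proof -
    define N where "N = length y + 1 + m y"
    define T where "T = nat \<lceil>poly r (real N)\<rceil>"
    have X_eq: "X y = {x. length x = m y \<and> (\<exists>t\<le>T. accepts_in M (pair_word y x) t)}"
    proof (intro equalityI subsetI CollectI conjI)
      fix x assume x: "x \<in> X y"
      then show len: "length x = m y"
        using X y by blast
      have "pair_word y x \<in> ntm_language M"
        using x y by (auto simp: lang)
      from bspec[OF p this] obtain t where t: "real t \<le> poly p (real N)" "accepts_in M (pair_word y x) t"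
        by (auto simp: length_pair_word len N_def)
      have "real t \<le> poly r (real N)"
        using t(1) r(2)[of "real N"] by simp
      then have "t \<le> T"
        unfolding T_def by linarith
      then show "\<exists>t\<le>T. accepts_in M (pair_word y x) t"
        using t by blast
    next
      fix x assume "x \<in> {x. length x = m y \<and> (\<exists>t\<le>T. accepts_in M (pair_word y x) t)}"
      then have "pair_word y x \<in> ntm_language M"
        by (auto simp: ntm_language_def)
      then show "x \<in> X y"
        using pair_word_inject by (auto simp: lang)
    qed
    have N: "real N \<le> poly n (real (length y))"
      using f[OF y] by (simp add: N_def n_def)
    have "real T \<le> poly r (real N) + 1"
      using r(1)[of "real N"] unfolding T_def by linarith
    also have "\<dots> \<le> poly s (real (length y))"
      using r(3)[OF _ N] by (simp add: s_def poly_pcompose)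
    finally have T: "real T \<le> poly s (real (length y))" .
    have "real (D * (2 * (T + N) + 1) * (T + 2)) \<le> poly g (real (length y))"
    proof -
      have "(2 * (real T + real N) + 1) * (real T + 2) \<le>
          (2 * (poly s (real (length y)) + poly n (real (length y))) + 1) * (poly s (real (length y)) + 2)"
        using N T by (intro mult_mono) auto
      then have "real D * ((2 * (real T + real N) + 1) * (real T + 2)) \<le> poly g (real (length y))"
        unfolding g_def by (simp add: mult_left_mono)
      then show ?thesis
        by (simp only: of_nat_mult of_nat_add of_nat_numeral of_nat_1 mult.assoc)
    qed
    moreover obtain d B where "block_configuration d B"
      and size: "config_size B \<le> D * (2 * (T + N) + 1) * (T + 2)"
      and "extension_by_coord_proj (ctp_coords B) (CTP B) {..<m y} (polytope01 (X y))"
      using block_configuration_of_bounded_computation[OF wf, of T y "m y"]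
      unfolding X_eq D_def N_def by blast
    moreover have "real (config_size B) \<le> real (D * (2 * (T + N) + 1) * (T + 2))"
      using size by (rule of_nat_mono)
    ultimately show ?thesis
      by (meson order_trans)
  qed
  then show ?thesis
    by blast
qed

end
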